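(* Let $\mathcal{S}_1$ and $\mathcal{S}_2$ be non-empty separated convex sets. If $\dim(\mathcal{S}_2) < \infty$, then both $\mathcal{A}^c(\widetilde{\mathcal{S}}_1,\mathcal{S}_2)$ and $\widetilde{\mathcal{A}}(\widetilde{\mathcal{S}}_1,\widetilde{\mathcal{S}}_2)$ are dense in $\mathcal{A}^c(\widetilde{\mathcal{S}}_1,\widetilde{\mathcal{S}}_2)$.
   Context: All vector spaces are real; convex sets are non-empty convex subsets of vector spaces. A convex set $\mathcal{S}$ is separated if for any distinct $s_1,s_2\in\mathcal{S}$ there is an affine functional $f:\mathcal{S}\to\mathbb{R}$ with bounded image and $f(s_1)\ne f(s_2)$. Associated to each separated convex set $\mathcal{S}$ is a collection $(\widetilde{\mathcal{S}},V(\mathcal{S}),\widetilde{V}(\mathcal{S}))$, which is known to exist and to be unique up to isomorphism, with the following properties: $V(\mathcal{S})$ and $\widetilde{V}(\mathcal{S})$ are locally convex Hausdorff topological vector spaces, $V(\mathcal{S})$ being a dense subspace of $\widetilde{V}(\mathcal{S})$; $\mathcal{S}$ is a convex subset of $V(\mathcal{S})$ with affine hull $V(\mathcal{S})$; the topology of $\widetilde{V}(\mathcal{S})$ is the weak topology induced by all continuous linear functionals on $\widetilde{V}(\mathcal{S})$; the topology of $V(\mathcal{S})$ is the weak topology induced by all linear functionals $f$ on $V(\mathcal{S})$ with $f(\mathcal{S})$ bounded; the subspace topology of $\mathcal{S}$ is the weak topology induced by all affine functions $\mathcal{S}\to[0,1]$; $\widetilde{\mathcal{S}}$ is the closure of $\mathcal{S}$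 in $\widetilde{V}(\mathcal{S})$, and it is convex, compact and complete, with affine hull $\widetilde{V}(\mathcal{S})$. $\mathcal{S}$ and $\widetilde{\mathcal{S}}$ carry these subspace topologies. If $\dim(\mathcal{S})=n<\infty$, then $V(\mathcal{S})=\widetilde{V}(\mathcal{S})$ is identified with the Euclidean space $\mathbb{R}^n$. An open subset $O$ of $\widetilde{\mathcal{S}}$ is essential if $\mathrm{int}_{\widetilde{\mathcal{S}}}(O\cup(\widetilde{\mathcal{S}}\setminus\mathcal{S}))=O$; a closed subset $C$ of $\widetilde{\mathcal{S}}$ is essential if $\mathrm{cl}_{\widetilde{\mathcal{S}}}(C\cap\mathcal{S})=C$ (interior and closure relative to $\widetilde{\mathcal{S}}$). $C(X,Y)$ is the set of continuous maps $X\to Y$. $\mathcal{A}^c(\widetilde{\mathcal{S}}_1,\widetilde{\mathcal{S}}_2)$ is the set of all continuous affine maps $\widetilde{\mathcal{S}}_1\to\widetilde{\mathcal{S}}_2$; $\mathcal{A}^c(\widetilde{\mathcal{S}}_1,\mathcal{S}_2)$ is its subset of all continuous affine maps $\widetilde{\mathcal{S}}_1\to\mathcal{S}_2$ (i.e. those with $f(\widetilde{\mathcal{S}}_1)\subset\mathcal{S}_2$); $\widetilde{\mathcal{A}}(\widetilde{\mathcal{S}}_1,\widetilde{\mathcal{S}}_2)$ is its subset of those $f$ with $f(\mathcal{S}_1)\subset\mathcal{S}_2$. Topology: $C(\widetilde{\mathcal{S}}_1,\widetilde{\mathcal{S}}_2)$ has the topology with subbase consisting of all sets $O_{K,U}=\{f\in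 C(\widetilde{\mathcal{S}}_1,\widetilde{\mathcal{S}}_2)\mid f(K)\subset U\}$ with $K$ an essential closed subset of $\widetilde{\mathcal{S}}_1$ and $U$ an essential open subset of $\widetilde{\mathcal{S}}_2$. $\mathcal{A}^c(\widetilde{\mathcal{S}}_1,\widetilde{\mathcal{S}}_2)$ has the subspace topology. *)

theory Defs
  imports "HOL-Analysis.Analysis"
begin

definition affine_on :: "'a::real_vector set \<Rightarrow> ('a \<Rightarrow> 'b::real_vector) \<Rightarrow> bool" where
  "affine_on S f \<longleftrightarrow>
     (\<forall>x\<in>S. \<forall>y\<in>S. \<forall>t\<in>{0..1}. f ((1 - t) *\<^sub>R x + t *\<^sub>R y) = (1 - t) *\<^sub>R f x + t *\<^sub>R f y)"

definition separated_convex_set :: "'a::real_vector set \<Rightarrow> bool" where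
  "separated_convex_set S \<longleftrightarrow> S \<noteq> {} \<and> convex S \<and>
     (\<forall>x\<in>S. \<forall>y\<in>S. x \<noteq> y \<longrightarrow>
        (\<exists>f :: 'a \<Rightarrow> real. affine_on S f \<and> bounded (f ` S) \<and> f x \<noteq> f y))"

text \<open>The dimension of a convex set is that of its affine hull. (The library's
  \<open>aff_dim\<close> is only available in Euclidean spaces.)\<close>

definition finite_dimensional_convex :: "'a::real_vector set \<Rightarrow> bool" where
  "finite_dimensional_convex S \<longleftrightarrow> (\<exists>B. finite B \<and> affine hull S \<subseteq> affine hull B)"

text \<open>Topological vector spaces are abstract topologies whose carrier is a linear subspace
  of an ambient real vector space; the vector space operations are inherited from it.\<close>

definition locally_convex_Hausdorff_tvs :: "'v::real_vector topology \<Rightarrow> bool" where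
  "locally_convex_Hausdorff_tvs T \<longleftrightarrow>
     subspace (topspace T) \<and> Hausdorff_space T \<and>
     continuous_map (prod_topology T T) T (\<lambda>(x, y). x + y) \<and>
     continuous_map (prod_topology euclideanreal T) T (\<lambda>(c, x). c *\<^sub>R x) \<and>
     (\<forall>U. openin T U \<and> 0 \<in> U \<longrightarrow> (\<exists>N. openin T N \<and> 0 \<in> N \<and> convex N \<and> N \<subseteq> U))"

definition complete_in_tvs :: "'v::real_vector topology \<Rightarrow> 'v set \<Rightarrow> bool" where
  "complete_in_tvs T A \<longleftrightarrow>
     (\<forall>F. F \<noteq> bot \<and> (\<forall>\<^sub>F x in F. x \<in> A) \<and>
          (\<forall>N. openin T N \<and> 0 \<in> N \<longrightarrow>
             (\<exists>P. eventually P F \<and> (\<forall>x y. P x \<and> P y \<longrightarrow> x - y \<in> N)))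
        \<longrightarrow> (\<exists>l\<in>A. limitin T (\<lambda>x. x) l F))"

definition linear_functional_on :: "'v::real_vector set \<Rightarrow> ('v \<Rightarrow> real) \<Rightarrow> bool" where
  "linear_functional_on V f \<longleftrightarrow>
     (\<forall>x\<in>V. \<forall>y\<in>V. f (x + y) = f x + f y) \<and> (\<forall>c. \<forall>x\<in>V. f (c *\<^sub>R x) = c * f x)"

definition weak_topology :: "'x set \<Rightarrow> ('x \<Rightarrow> real) set \<Rightarrow> 'x topology" where
  "weak_topology X F = topology_generated_by {{x \<in> X. f x \<in> U} |f U. f \<in> F \<and> open U}"

text \<open>The triple attached to a separated convex set \<open>S\<close>: \<open>C\<close> is the compactification
  of \<open>S\<close>, \<open>V\<close> is the affine hull of \<open>S\<close>, and \<open>T\<close> is the topology of the completed space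
  \<open>W = topspace T\<close>. \<open>S\<close> may live in an arbitrary vector space; the affine injection \<open>j\<close>
  performs its identification with a convex subset of \<open>V\<close> (\<open>j = id\<close> if it is already one).
  \<open>V\<close>, \<open>S\<close> and \<open>C\<close> carry the subspace topologies of \<open>T\<close>.\<close>

locale convex_completion =
  fixes S :: "'a::real_vector set"
    and j :: "'a \<Rightarrow> 'v::real_vector"
    and C V :: "'v set"
    and T :: "'v topology"
  assumes affine_embedding: "affine_on S j" "inj_on j S"
    and tvs_completed: "locally_convex_Hausdorff_tvs T"
    and tvs_V: "locally_convex_Hausdorff_tvs (subtopology T V)"
    and subspace_V: "subspace V" "V \<subseteq> topspace T"
    and dense_V: "T closure_of V = topspace T"
    and embedded: "j ` S \<subseteq> V" "convex (j ` S)" "affine hull (j ` S) = V"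
    and topology_completed:
      "T = weak_topology (topspace T)
             {f. linear_functional_on (topspace T) f \<and> continuous_map T euclideanreal f}"
    and topology_V:
      "subtopology T V = weak_topology V {f. linear_functional_on V f \<and> bounded (f ` j ` S)}"
    and topology_S:
      "subtopology T (j ` S) =
         weak_topology (j ` S) {f. affine_on (j ` S) f \<and> f ` j ` S \<subseteq> {0..1}}"
    and C_closure: "C = T closure_of (j ` S)"
    and C_properties: "convex C" "compactin T C" "complete_in_tvs T C"
    and affine_hull_C: "affine hull C = topspace T"

text \<open>Below, \<open>X\<close> is the topological space on the compactification and \<open>S \<subseteq> topspace X\<close> the
  embedded convex set.\<close>

definition essential_openin :: "'v topology \<Rightarrow> 'v set \<Rightarrow> 'v set \<Rightarrow> bool" where
  "essential_openin X S U \<longleftrightarrow> openin X U \<and> X interior_of (U \<union> (topspace X - S)) = U"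

definition essential_closedin :: "'v topology \<Rightarrow> 'v set \<Rightarrow> 'v set \<Rightarrow> bool" where
  "essential_closedin X S K \<longleftrightarrow> closedin X K \<and> X closure_of (K \<inter> S) = K"

text \<open>Maps between spaces are represented by extensional functions, so that equality of
  functions is equality of maps.\<close>

definition continuous_maps :: "'v topology \<Rightarrow> 'w topology \<Rightarrow> ('v \<Rightarrow> 'w) set" where
  "continuous_maps X Y = {f \<in> topspace X \<rightarrow>\<^sub>E topspace Y. continuous_map X Y f}"

definition continuous_affine_maps ::
    "'v::real_vector topology \<Rightarrow> 'w::real_vector topology \<Rightarrow> ('v \<Rightarrow> 'w) set" where
  "continuous_affine_maps X Y = {f \<in> continuous_maps X Y. affine_on (topspace X) f}"

definition continuous_affine_maps_into ::
    "'v::real_vector topology \<Rightarrow> 'w::real_vector topology \<Rightarrow> 'w set \<Rightarrow> ('v \<Rightarrow> 'w) set" where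
  "continuous_affine_maps_into X Y S2 = {f \<in> continuous_affine_maps X Y. f ` topspace X \<subseteq> S2}"

definition continuous_affine_maps_preserving ::
    "'v::real_vector topology \<Rightarrow> 'v set \<Rightarrow> 'w::real_vector topology \<Rightarrow> 'w set \<Rightarrow> ('v \<Rightarrow> 'w) set"
  where
  "continuous_affine_maps_preserving X S1 Y S2 =
     {f \<in> continuous_affine_maps X Y. f ` S1 \<subseteq> S2}"

text \<open>The sets listed form a subbase of the topology; the choice \<open>K = {}\<close> shows that they
  cover \<open>continuous_maps X Y\<close>.\<close>

definition essential_open_topology ::
    "'v topology \<Rightarrow> 'v set \<Rightarrow> 'w topology \<Rightarrow> 'w set \<Rightarrow> ('v \<Rightarrow> 'w) topology" where
  "essential_open_topology X S1 Y S2 =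
     topology_generated_by
       {{f \<in> continuous_maps X Y. f ` K \<subseteq> U} |K U.
          essential_closedin X S1 K \<and> essential_openin Y S2 U}"

lemma topspace_essential_open_topology:
  "topspace (essential_open_topology X S1 Y S2) = continuous_maps X Y"
proof -
  have K: "essential_closedin X S1 {}"
    by (simp add: essential_closedin_def)
  have U: "essential_openin Y S2 (topspace Y)"
    by (simp add: essential_openin_def Un_absorb2)
  have "{f \<in> continuous_maps X Y. f ` {} \<subseteq> topspace Y}
      \<in> {{f \<in> continuous_maps X Y. f ` K \<subseteq> U} |K U.
            essential_closedin X S1 K \<and> essential_openin Y S2 U}"
    using K U by blast
  then have "continuous_maps X Y \<subseteq> topspace (essential_open_topology X S1 Y S2)"
    unfolding essential_open_topology_def topology_generated_by_topspace by auto
  moreover have "topspace (essential_open_topology X S1 Y S2) \<subseteq> continuous_maps X Y"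
    unfolding essential_open_topology_def topology_generated_by_topspace by auto
  ultimately show ?thesis by blast
qed

definition dense_in :: "'x topology \<Rightarrow> 'x set \<Rightarrow> bool" where
  "dense_in X D \<longleftrightarrow> D \<subseteq> topspace X \<and> X closure_of D = topspace X"

end

theory Submission
  imports Defs
begin

text \<open>Push \<open>f\<close> towards a point \<open>q\<close> of the relative interior of \<open>j2 ` S2\<close>: the maps
  \<open>(1 - e) f + e q\<close> take the closure \<open>C2\<close> of \<open>j2 ` S2\<close> into \<open>j2 ` S2\<close> for \<open>0 < e \<le> 1\<close>,
  and by the tube lemma they lie in any given subbasic neighbourhood of \<open>f\<close> as \<open>e\<close> tends to 0.
  The relative interior is non-empty because the topology of the finite-dimensional space
  \<open>V2\<close> makes all linear functionals continuous and \<open>j2 ` S2\<close> contains a simplex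
  of full dimension.\<close>

section \<open>Continuity and separation of points in topological vector spaces\<close>

lemma tvs_continuous_map_add:
  assumes "locally_convex_Hausdorff_tvs T" "continuous_map X T f" "continuous_map X T g"
  shows "continuous_map X T (\<lambda>x. f x + g x)"
proof -
  have "continuous_map X (prod_topology T T) (\<lambda>x. (f x, g x))"
    using assms by (simp add: continuous_map_pairedI)
  moreover have "continuous_map (prod_topology T T) T (\<lambda>(x, y). x + y)"
    using assms(1) by (simp add: locally_convex_Hausdorff_tvs_def)
  ultimately show ?thesis
    using continuous_map_compose by (fastforce simp: o_def)
qed

lemma tvs_continuous_map_scaleR:
  assumes "locally_convex_Hausdorff_tvs T"
    "continuous_map X euclideanreal c" "continuous_map X T g"
  shows "continuous_map X T (\<lambda>x. c x *\<^sub>R g x)"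
proof -
  have "continuous_map X (prod_topology euclideanreal T) (\<lambda>x. (c x, g x))"
    using assms by (simp add: continuous_map_pairedI)
  moreover have "continuous_map (prod_topology euclideanreal T) T (\<lambda>(c, x). c *\<^sub>R x)"
    using assms(1) by (simp add: locally_convex_Hausdorff_tvs_def)
  ultimately show ?thesis
    using continuous_map_compose by (fastforce simp: o_def)
qed

text \<open>If all of \<open>F\<close> agreed at \<open>x\<close> and \<open>y\<close>, each
  subbasic set would contain both points or neither. This passes to finite intersections and unions,
  hence to all open sets, against the Hausdorff property.\<close>

lemma weak_topology_separating:
  assumes T: "T = weak_topology X F" and "Hausdorff_space T"
    and "x \<in> topspace T" "y \<in> topspace T" "x \<noteq> y"
  obtains f where "f \<in> F" "f x \<noteq> f y"
proof (rule ccontr)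
  assume "\<not> thesis"
  with that have same: "\<And>f. f \<in> F \<Longrightarrow> f x = f y" by blast
  obtain U where U: "openin T U" "x \<in> U" "y \<notin> U"
    using assms(2-5) unfolding Hausdorff_space_def disjnt_iff by meson
  have "x \<in> X" "y \<in> X"
    using assms(3,4) unfolding T weak_topology_def topology_generated_by_topspace by auto
  have "generate_topology_on {{x \<in> X. f x \<in> U} |f U. f \<in> F \<and> open U} U"
    using U(1) openin_topology_generated_by unfolding T weak_topology_def by auto
  then have "x \<in> U \<longleftrightarrow> y \<in> U"
  proof induction
    case (Basis s)
    then obtain f U where "s = {x \<in> X. f x \<in> U}" "f \<in> F" by blast
    then show ?case using same[of f] \<open>x \<in> X\<close> \<open>y \<in> X\<close> by simp
  qed auto
  with U show False by blast
qed

section \<open>Continuous projections onto finite-dimensional subspaces\<close>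

lemma linear_functional_on_zero:
  assumes "linear_functional_on V f" "subspace V"
  shows "f 0 = 0"
proof -
  have "f (0 *\<^sub>R 0) = 0 * f 0"
    using assms subspace_0 unfolding linear_functional_on_def by blast
  then show ?thesis by simp
qed

text \<open>The last conjunct says that the projection has continuous coordinates. Adding a vector \<open>b\<close> adds the term \<open>\<psi> y *\<^sub>R d\<close> with \<open>d = b - P b\<close>, where
  \<open>\<psi>\<close> vanishes on \<open>span B\<close> and takes the value 1 at \<open>b\<close>.\<close>

lemma finite_span_projection:
  fixes T :: "'v::real_vector topology"
  assumes tvs: "locally_convex_Hausdorff_tvs T"
    and sep: "\<And>x. x \<in> topspace T \<Longrightarrow> x \<noteq> 0 \<Longrightarrow>
      \<exists>f. linear_functional_on (topspace T) f \<and> continuous_map T euclideanreal f \<and> f x \<noteq> 0"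
    and "finite B" "B \<subseteq> topspace T"
  shows "\<exists>P. P ` topspace T \<subseteq> span B \<and> (\<forall>x\<in>span B. P x = x) \<and>
      (\<forall>x\<in>topspace T. \<forall>y\<in>topspace T. P (x + y) = P x + P y) \<and>
      (\<forall>c. \<forall>x\<in>topspace T. P (c *\<^sub>R x) = c *\<^sub>R P x) \<and>
      continuous_map T T P \<and>
      (\<forall>g. linear_functional_on (topspace T) g \<longrightarrow> continuous_map T euclideanreal (g \<circ> P))"
  using assms(3,4)
proof (induction B)
  case empty
  have "0 \<in> topspace T"
    using tvs subspace_0 unfolding locally_convex_Hausdorff_tvs_def by blast
  then show ?case
    by (intro exI[of _ "\<lambda>_. 0"]) (auto simp: o_def)
next
  case (insert b B)
  let ?W = "topspace T"
  have W: "subspace ?W"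
    using tvs unfolding locally_convex_Hausdorff_tvs_def by blast
  have "B \<subseteq> ?W" using insert.prems by simp
  from insert.IH[OF this] obtain P where
    P_span: "P ` ?W \<subseteq> span B" and P_id: "\<And>x. x \<in> span B \<Longrightarrow> P x = x" and
    P_add: "\<And>x y. x \<in> ?W \<Longrightarrow> y \<in> ?W \<Longrightarrow> P (x + y) = P x + P y" and
    P_scale: "\<And>c x. x \<in> ?W \<Longrightarrow> P (c *\<^sub>R x) = c *\<^sub>R P x" and
    P_cont: "continuous_map T T P" and
    P_coord: "\<And>g. linear_functional_on ?W g \<Longrightarrow> continuous_map T euclideanreal (g \<circ> P)"
    by metis
  have spanW: "span B \<subseteq> ?W" "span (insert b B) \<subseteq> ?W"
    using insert.prems W by (intro span_minimal; simp)+
  show ?case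
  proof (cases "b \<in> span B")
    case True
    then have "span (insert b B) = span B" by (rule span_redundant)
    then show ?thesis
      using P_span P_id P_add P_scale P_cont P_coord by (intro exI[of _ P]) (simp add: o_def)
  next
    case False
    define d where "d = b - P b"
    have b: "b \<in> ?W" "P b \<in> span B" "P b \<in> ?W"
      using insert.prems P_span spanW by auto
    have d: "d \<in> ?W" "d \<noteq> 0"
      using b False W subspace_diff by (auto simp: d_def)
    obtain f where f: "linear_functional_on ?W f" "continuous_map T euclideanreal f" "f d \<noteq> 0"
      using sep[OF d] by blast
    have f_add: "f (x + y) = f x + f y" if "x \<in> ?W" "y \<in> ?W" for x y
      using f(1) that by (auto simp: linear_functional_on_def)
    have f_scale: "f (c *\<^sub>R x) = c * f x" if "x \<in> ?W" for c x
      using f(1) that by (auto simp: linear_functional_on_def)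
    have PW: "P x \<in> ?W" if "x \<in> ?W" for x
      using that P_span spanW by auto
    \<comment> \<open>This is \<open>f (y - P y) / f d\<close> by linearity: it vanishes where
      \<open>P\<close> is the identity, and \<open>b - P b = d\<close> gives the value 1 at
      \<open>b\<close>.\<close>
    define \<psi> where "\<psi> y = (f y - f (P y)) / f d" for y
    have \<psi>_add: "\<psi> (x + y) = \<psi> x + \<psi> y" if "x \<in> ?W" "y \<in> ?W" for x y
      using that by (simp add: \<psi>_def f_add P_add PW add_divide_distrib diff_divide_distrib)
    have \<psi>_scale: "\<psi> (c *\<^sub>R x) = c * \<psi> x" if "x \<in> ?W" for c x
      using that by (simp add: \<psi>_def f_scale P_scale PW flip: right_diff_distrib)
    have \<psi>_cont: "continuous_map T euclideanreal \<psi>"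
      unfolding \<psi>_def using f(2) P_coord[OF f(1)] f(3)
      by (intro continuous_intros) (auto simp: o_def)
    have \<psi>_b: "\<psi> b = 1"
    proof -
      have "f b = f (P b) + f d"
        using f_add[OF b(3) d(1)] by (simp add: d_def)
      then show ?thesis using f(3) by (simp add: \<psi>_def)
    qed
    have \<psi>_0: "\<psi> x = 0" if "x \<in> span B" for x
      using that by (simp add: \<psi>_def P_id)
    define Q where "Q y = P y + \<psi> y *\<^sub>R d" for y
    have spB: "span B \<subseteq> span (insert b B)" by (simp add: span_mono subset_insertI)
    have dsp: "d \<in> span (insert b B)"
      unfolding d_def using b(2) spB by (intro span_diff) (auto simp: span_base)
    have Q_span: "Q ` ?W \<subseteq> span (insert b B)"
      unfolding Q_def using P_span spB dsp by (auto intro!: span_add span_scale)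
    have Q_add: "Q (x + y) = Q x + Q y" if "x \<in> ?W" "y \<in> ?W" for x y
      using that by (simp add: Q_def P_add \<psi>_add scaleR_add_left)
    have Q_scale: "Q (c *\<^sub>R x) = c *\<^sub>R Q x" if "x \<in> ?W" for c x
      using that by (simp add: Q_def P_scale \<psi>_scale scaleR_add_right)
    \<comment> \<open>Split off the multiple of \<open>b\<close>: on \<open>span B\<close> the
      correction term vanishes, and \<open>Q b = P b + d = b\<close>.\<close>
    have Q_id: "Q x = x" if x: "x \<in> span (insert b B)" for x
    proof -
      obtain k where k: "x - k *\<^sub>R b \<in> span B"
        using x span_breakdown_eq[of x b B] by blast
      have "Q x = Q ((x - k *\<^sub>R b) + k *\<^sub>R b)" by simp
      also have "\<dots> = Q (x - k *\<^sub>R b) + k *\<^sub>R Q b"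
        using k spanW b(1) W by (subst Q_add) (auto simp: Q_scale intro: subspace_scale)
      also have "\<dots> = x"
        using k by (simp add: Q_def P_id \<psi>_0 \<psi>_b d_def)
      finally show ?thesis .
    qed
    have Q_cont: "continuous_map T T Q"
      unfolding Q_def using P_cont \<psi>_cont d(1)
      by (intro tvs_continuous_map_add[OF tvs] tvs_continuous_map_scaleR[OF tvs]) auto
    \<comment> \<open>Here \<open>g\<close> is only linear. Its continuity along \<open>Q\<close>
      comes from \<open>P\<close> and \<open>\<psi>\<close>, because \<open>g d\<close> is a
      constant. This later makes every linear functional on \<open>V\<close> continuous.\<close>
    have Q_coord: "continuous_map T euclideanreal (g \<circ> Q)"
      if g: "linear_functional_on ?W g" for g
    proof -
      have "continuous_map T euclideanreal (\<lambda>y. g (P y) + \<psi> y * g d)"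
        using P_coord[OF g] \<psi>_cont by (intro continuous_intros) (auto simp: o_def)
      moreover have "(g \<circ> Q) y = g (P y) + \<psi> y * g d" if "y \<in> ?W" for y
        using g PW[OF that] d(1) W
        by (simp add: Q_def linear_functional_on_def subspace_scale)
      ultimately show ?thesis
        by (metis (no_types, lifting) continuous_map_eq)
    qed
    show ?thesis
      using Q_span Q_id Q_add Q_scale Q_cont Q_coord by (intro exI[of _ Q]) (simp add: o_def)
  qed
qed

section \<open>Finite-dimensionality of affine images\<close>

text \<open>\<open>j\<close> is affine on \<open>S\<close> only, so its linear part is built as a
  relation on differences of points of \<open>S\<close>. Being a single-valued linear relation with
  finite-dimensional domain, it has a finite-dimensional range; one base point \<open>j p\<close>
  then accounts for the translation.\<close>

lemma affine_image_finite_dimensional: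
  fixes S :: "'a::real_vector set" and j :: "'a \<Rightarrow> 'v::real_vector"
  assumes "affine_on S j" "convex S" "finite_dimensional_convex S"
  shows "\<exists>E. finite E \<and> affine hull (j ` S) \<subseteq> span E"
proof (cases "S = {}")
  case True
  then show ?thesis by (auto intro: exI[of _ "{}"])
next
  case False
  then obtain p where p: "p \<in> S" by blast
  obtain B where B: "finite B" "affine hull S \<subseteq> affine hull B"
    using assms(3) unfolding finite_dimensional_convex_def by blast
  have SB: "S \<subseteq> span B"
    using B(2) hull_subset[of S affine] affine_hull_subset_span[of B] by blast
  \<comment> \<open>\<open>H\<close> is the graph of the linear part of \<open>j\<close>.\<close>
  define H where "H = {(t *\<^sub>R (x - y), t *\<^sub>R (j x - j y)) |t x y. 0 \<le> t \<and> x \<in> S \<and> y \<in> S}"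
  have HI: "(t *\<^sub>R (x - y), t *\<^sub>R (j x - j y)) \<in> H" if "0 \<le> t" "x \<in> S" "y \<in> S" for t x y
    unfolding H_def using that by blast
  \<comment> \<open>Weighted means stay in \<open>S\<close> and are respected by \<open>j\<close>.
    This merges two scaled differences into one: \<open>t (x - y) + u (x' - y')\<close> is
    \<open>t + u\<close> times the difference of the mean of \<open>x\<close>, \<open>x'\<close> and
    the mean of \<open>y\<close>, \<open>y'\<close>.\<close>
  have comb: "(t *\<^sub>R x + u *\<^sub>R x') /\<^sub>R (t + u) \<in> S \<and>
      j ((t *\<^sub>R x + u *\<^sub>R x') /\<^sub>R (t + u)) = (t *\<^sub>R j x + u *\<^sub>R j x') /\<^sub>R (t + u)"
    if "0 \<le> t" "0 \<le> u" "t + u > 0" "x \<in> S" "x' \<in> S" for t u :: real and x x'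
  proof -
    define s where "s = u / (t + u)"
    have s: "s \<in> {0..1}" using that by (auto simp: s_def)
    have s1: "1 - s = t / (t + u)" using that by (simp add: s_def field_simps)
    have e: "(t *\<^sub>R v + u *\<^sub>R v') /\<^sub>R (t + u) = (1 - s) *\<^sub>R v + s *\<^sub>R v'" for v v' :: 'a
      unfolding s1 by (simp add: s_def scaleR_add_right divide_inverse mult.commute)
    have e': "(t *\<^sub>R v + u *\<^sub>R v') /\<^sub>R (t + u) = (1 - s) *\<^sub>R v + s *\<^sub>R v'" for v v' :: 'v
      unfolding s1 by (simp add: s_def scaleR_add_right divide_inverse mult.commute)
    show ?thesis
      unfolding e e' using that s assms(1) convexD_alt[OF assms(2)] by (auto simp: affine_on_def)
  qed
  have H: "subspace H"
  proof (rule subspaceI)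
    show "0 \<in> H" using HI[of 0 p p] p by (simp add: zero_prod_def)
  next
    fix a b assume "a \<in> H" "b \<in> H"
    then obtain t x y u x' y' where a: "a = (t *\<^sub>R (x - y), t *\<^sub>R (j x - j y))"
      "0 \<le> t" "x \<in> S" "y \<in> S" and b: "b = (u *\<^sub>R (x' - y'), u *\<^sub>R (j x' - j y'))"
      "0 \<le> u" "x' \<in> S" "y' \<in> S"
      unfolding H_def by auto
    show "a + b \<in> H"
    proof (cases "t + u > 0")
      case False
      then have "t = 0" "u = 0" using a b by auto
      then show ?thesis using a b HI[of 0 x y] by simp
    next
      case True
      have x: "(t *\<^sub>R x + u *\<^sub>R x') /\<^sub>R (t + u) \<in> S"
        "j ((t *\<^sub>R x + u *\<^sub>R x') /\<^sub>R (t + u)) = (t *\<^sub>R j x + u *\<^sub>R j x') /\<^sub>R (t + u)"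
        using comb[of t u x x'] a b True by auto
      have y: "(t *\<^sub>R y + u *\<^sub>R y') /\<^sub>R (t + u) \<in> S"
        "j ((t *\<^sub>R y + u *\<^sub>R y') /\<^sub>R (t + u)) = (t *\<^sub>R j y + u *\<^sub>R j y') /\<^sub>R (t + u)"
        using comb[of t u y y'] a b True by auto
      have "t + u \<ge> 0" using True by simp
      from HI[OF this x(1) y(1)]
      have "(t *\<^sub>R x + u *\<^sub>R x' - (t *\<^sub>R y + u *\<^sub>R y'),
          t *\<^sub>R j x + u *\<^sub>R j x' - (t *\<^sub>R j y + u *\<^sub>R j y')) \<in> H"
        unfolding x(2) y(2) using True by (simp add: scaleR_diff_right)
      also have "(t *\<^sub>R x + u *\<^sub>R x' - (t *\<^sub>R y + u *\<^sub>R y'),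
          t *\<^sub>R j x + u *\<^sub>R j x' - (t *\<^sub>R j y + u *\<^sub>R j y')) = a + b"
        by (simp add: a(1) b(1) algebra_simps)
      finally show ?thesis .
    qed
  next
    fix c a assume "a \<in> H"
    then obtain t x y where a: "a = (t *\<^sub>R (x - y), t *\<^sub>R (j x - j y))" "0 \<le> t" "x \<in> S" "y \<in> S"
      unfolding H_def by auto
    show "c *\<^sub>R a \<in> H"
    proof (cases "c \<ge> 0")
      case True
      then show ?thesis using HI[of "c * t" x y] a by simp
    next
      case False
      \<comment> \<open>The coefficient in \<open>H\<close> must be nonnegative, so a negative sign
        is absorbed by swapping \<open>x\<close> and \<open>y\<close>.\<close>
      then have "- c * t \<ge> 0" using a(2) by (simp add: mult_le_0_iff)
      then have "((- c * t) *\<^sub>R (y - x), (- c * t) *\<^sub>R (j y - j x)) \<in> H"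
        using HI a by blast
      moreover have "((- c * t) *\<^sub>R (y - x), (- c * t) *\<^sub>R (j y - j x)) = c *\<^sub>R a"
        unfolding a(1) by (simp add: algebra_simps)
      ultimately show ?thesis by simp
    qed
  qed
  \<comment> \<open>Single-valuedness: \<open>t (x - y) = 0\<close> forces \<open>t = 0\<close> or
    \<open>x = y\<close>, and either one kills the second component.\<close>
  have H0: "w = 0" if "(0, w) \<in> H" for w
    using that unfolding H_def by auto
  obtain D where D: "D \<subseteq> fst ` H" "independent D" "fst ` H \<subseteq> span D"
    by (rule maximal_independent_subset)
  have "fst ` H \<subseteq> span B"
    unfolding H_def using SB by (auto intro!: span_scale span_diff)
  then have finD: "finite D"
    using independent_span_bound[OF B(1) D(2)] D(1) by blast
  have "\<forall>d\<in>D. \<exists>w. (d, w) \<in> H" using D(1) by force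
  then obtain w where w: "\<And>d. d \<in> D \<Longrightarrow> (d, w d) \<in> H" by metis
  have snd_H: "b \<in> span (w ` D)" if ab: "(a, b) \<in> H" for a b
  proof -
    have "a \<in> span D" using ab D(3) by force
    then obtain c where c: "a = (\<Sum>d\<in>D. c d *\<^sub>R d)"
      unfolding span_finite[OF finD] by auto
    have "(\<Sum>d\<in>D. c d *\<^sub>R (d, w d)) \<in> H"
      using H w by (intro subspace_sum subspace_scale) auto
    then have "(a, b) - (\<Sum>d\<in>D. c d *\<^sub>R (d, w d)) \<in> H"
      using ab H by (intro subspace_diff)
    moreover have "(a, b) - (\<Sum>d\<in>D. c d *\<^sub>R (d, w d)) = (0, b - (\<Sum>d\<in>D. c d *\<^sub>R w d))"
      by (simp add: prod_eq_iff fst_sum snd_sum c)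
    ultimately have "b = (\<Sum>d\<in>D. c d *\<^sub>R w d)" using H0 by force
    then show ?thesis by (simp add: span_sum span_scale span_base)
  qed
  let ?E = "insert (j p) (w ` D)"
  have "j x \<in> span ?E" if "x \<in> S" for x
  proof -
    have "j x - j p \<in> span (w ` D)"
      using snd_H[of "x - p" "j x - j p"] HI[of 1 x p] that p by simp
    then have "j x - j p \<in> span ?E"
      using span_mono[of "w ` D" ?E] by auto
    moreover have "j p \<in> span ?E" by (simp add: span_base)
    ultimately have "(j x - j p) + j p \<in> span ?E" by (rule span_add)
    then show ?thesis by simp
  qed
  then have "affine hull (j ` S) \<subseteq> span ?E"
    by (intro hull_minimal) (auto simp: subspace_imp_affine)
  then show ?thesis using finD by (intro exI[of _ ?E]) simp
qed

section \<open>Simplices, linear functionals and interior points in finite dimension\<close>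

text \<open>With \<open>s = sum c D\<close> the point is \<open>(1 - s) a + s z\<close>, where
  \<open>z\<close> is the convex combination of the vertices \<open>a + d\<close> with weights
  \<open>c d / s\<close>; only \<open>s = 0\<close> needs separate treatment.\<close>

lemma simplex_combination_mem:
  assumes "convex K" "a \<in> K" "finite D" "(\<lambda>d. a + d) ` D \<subseteq> K"
    and "\<And>d. d \<in> D \<Longrightarrow> 0 \<le> c d" "sum c D \<le> 1"
  shows "a + (\<Sum>d\<in>D. c d *\<^sub>R d) \<in> K"
proof (cases "sum c D = 0")
  case True
  then have "\<forall>d\<in>D. c d = 0" using assms(3,5) by (simp add: sum_nonneg_eq_0_iff)
  then show ?thesis using assms(2) by simp
next
  case False
  define s where "s = sum c D"
  have s: "0 < s" "s \<le> 1"
    using False assms(5,6) sum_nonneg[of D c] by (auto simp: s_def)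
  have "(\<Sum>d\<in>D. (c d / s) *\<^sub>R (a + d)) \<in> K"
    using assms s by (intro convex_sum) (auto simp: s_def sum_divide_distrib[symmetric])
  then have "(1 - s) *\<^sub>R a + s *\<^sub>R (\<Sum>d\<in>D. (c d / s) *\<^sub>R (a + d)) \<in> K"
    using assms(1,2) s by (intro convexD_alt) auto
  moreover have "s *\<^sub>R (\<Sum>d\<in>D. (c d / s) *\<^sub>R (a + d)) = s *\<^sub>R a + (\<Sum>d\<in>D. c d *\<^sub>R d)"
  proof -
    have "s *\<^sub>R (\<Sum>d\<in>D. (c d / s) *\<^sub>R (a + d)) = (\<Sum>d\<in>D. c d *\<^sub>R a + c d *\<^sub>R d)"
      using s by (simp add: scaleR_sum_right scaleR_add_right)
    then show ?thesis by (simp add: sum.distrib s_def scaleR_sum_left)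
  qed
  moreover have "(1 - s) *\<^sub>R a + s *\<^sub>R a = a" by (simp add: algebra_simps)
  ultimately show ?thesis by (simp flip: add.assoc)
qed

locale finite_dimensional_convex_completion = convex_completion S j C V T
  for S :: "'a::real_vector set" and j :: "'a \<Rightarrow> 'v::real_vector"
    and C V :: "'v set" and T :: "'v topology" +
  assumes S: "S \<noteq> {}" "convex S" "finite_dimensional_convex S"
begin

text \<open>\<open>T\<close> is Hausdorff and is the weak topology of its continuous linear
  functionals, so one of them distinguishes \<open>x\<close> from 0. This supplies the separation
  hypothesis of \<open>finite_span_projection\<close>.\<close>

lemma separating_functional:
  assumes "x \<in> topspace T" "x \<noteq> 0"
  shows "\<exists>f. linear_functional_on (topspace T) f \<and> continuous_map T euclideanreal f \<and> f x \<noteq> 0"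
proof -
  have W: "subspace (topspace T)" and hd: "Hausdorff_space T"
    using tvs_completed unfolding locally_convex_Hausdorff_tvs_def by auto
  have "0 \<in> topspace T" using W subspace_0 by blast
  with weak_topology_separating[OF topology_completed hd assms(1) _ assms(2)]
  obtain f where "linear_functional_on (topspace T) f" "continuous_map T euclideanreal f" "f x \<noteq> f 0"
    by auto
  then show ?thesis using linear_functional_on_zero[OF _ W] by auto
qed

lemma finite_basis:
  obtains E where "finite E" "V = span E"
proof -
  obtain E where E: "finite E" "V \<subseteq> span E"
    using affine_image_finite_dimensional[OF affine_embedding(1) S(2,3)] embedded(3) by auto
  obtain D where D: "D \<subseteq> V" "independent D" "V \<subseteq> span D"
    by (rule maximal_independent_subset)
  have "finite D" using independent_span_bound[OF E(1) D(2)] D(1) E(2) by blast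
  moreover have "V = span D"
    using D(1,3) span_minimal[OF _ subspace_V(1)] by blast
  ultimately show ?thesis using that by blast
qed

text \<open>The continuous projection \<open>P\<close> onto \<open>V\<close> agrees with the
  identity on the dense set \<open>V\<close>, hence everywhere since \<open>T\<close> is Hausdorff;
  so its range \<open>V\<close> is the whole space. Then \<open>f\<close> coincides with
  \<open>f \<circ> P\<close>, which is continuous by the coordinate property.\<close>

lemma
  shows topspace_eq_V: "topspace T = V"
    and continuous_linear_functional:
      "linear_functional_on V f \<Longrightarrow> continuous_map T euclideanreal f"
proof -
  obtain E where E: "finite E" "V = span E" by (rule finite_basis)
  have "E \<subseteq> topspace T" using E(2) subspace_V(2) span_superset by blast
  from finite_span_projection[OF tvs_completed separating_functional E(1) this]
  obtain P where P: "P ` topspace T \<subseteq> V" "\<And>x. x \<in> V \<Longrightarrow> P x = x" "continuous_map T T P"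
    and coord: "\<And>g. linear_functional_on (topspace T) g \<Longrightarrow> continuous_map T euclideanreal (g \<circ> P)"
    unfolding E(2)[symmetric] by metis
  have hd: "Hausdorff_space T"
    using tvs_completed unfolding locally_convex_Hausdorff_tvs_def by blast
  have P_id: "P x = x" if "x \<in> topspace T" for x
    using forall_in_closure_of_eq[of x T V T P "\<lambda>x. x"] that dense_V hd P by auto
  then show W: "topspace T = V"
    using P(1) subspace_V(2) by (metis image_subset_iff subsetI subset_antisym)
  assume "linear_functional_on V f"
  then have "continuous_map T euclideanreal (f \<circ> P)"
    using coord W by simp
  then show "continuous_map T euclideanreal f"
    by (rule continuous_map_eq) (simp add: P_id)
qed

lemma interior_point_exists:
  obtains q U where "q \<in> j ` S" "openin T U" "0 \<in> U" "(\<lambda>u. q + u) ` U \<subseteq> j ` S"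
proof -
  let ?K = "j ` S"
  obtain p where p: "p \<in> ?K" using S(1) by blast
  obtain D where D: "D \<subseteq> (\<lambda>x. - p + x) ` ?K" "independent D" "(\<lambda>x. - p + x) ` ?K \<subseteq> span D"
    by (rule maximal_independent_subset)
  have pK: "p \<in> V" "?K \<subseteq> V" using p embedded(1) by auto
  then have KV: "(\<lambda>x. - p + x) ` ?K \<subseteq> V"
    using subspace_V(1) by (auto simp: subspace_diff image_subset_iff)
  obtain E where E: "finite E" "V = span E" by (rule finite_basis)
  have fin: "finite D"
    using independent_span_bound[OF E(1) D(2)] D(1) KV E(2) by blast
  have "V = (\<lambda>x. p + x) ` span ((\<lambda>x. - p + x) ` ?K)"
    using affine_hull_insert_span_gen[of p ?K] p embedded(3) by (simp add: insert_absorb)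
  also have "span ((\<lambda>x. - p + x) ` ?K) = span D"
    using D(1,3) by (metis span_mono span_span subset_antisym)
  finally have V: "V = (\<lambda>x. p + x) ` span D" .
  have VD: "V = span D"
  proof
    show "span D \<subseteq> V" using D(1) KV subspace_V(1) by (meson order_trans span_minimal)
    show "V \<subseteq> span D"
    proof
      fix v assume "v \<in> V"
      then have "p + v \<in> V" using pK subspace_V(1) by (simp add: subspace_add)
      then show "v \<in> span D" using V by auto
    qed
  qed
  \<comment> \<open>\<open>m\<close> counts the vertices \<open>p\<close> and \<open>p + d\<close>
    of the simplex, which makes \<open>q\<close> below its barycentre.\<close>
  define m where "m = real (card D) + 1"
  have m: "m > 0" by (simp add: m_def)
  define q where "q = p + (\<Sum>d\<in>D. (1 / m) *\<^sub>R d)"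
  \<comment> \<open>Coordinates perturbed by less than \<open>1 / m^2\<close> stay nonnegative, as
    \<open>1 / m^2 \<le> 1 / m\<close>, and their sum is at most
    \<open>(m - 1) * (1 / m + 1 / m^2) = 1 - 1 / m^2\<close>. Intersecting with
    \<open>topspace T\<close> covers empty \<open>D\<close>, where the indexed intersection is
    everything.\<close>
  define U where "U = topspace T \<inter> (\<Inter>d\<in>D. {v \<in> topspace T. representation D v d \<in> {- (1 / m^2)<..<1 / m^2}})"
  have memK: "p + (\<Sum>d\<in>D. c d *\<^sub>R d) \<in> ?K"
    if "\<And>d. d \<in> D \<Longrightarrow> 0 \<le> c d" "sum c D \<le> 1" for c
  proof -
    have "(\<lambda>d. p + d) ` D \<subseteq> ?K" using D(1) by auto
    from simplex_combination_mem[OF embedded(2) p fin this that] show ?thesis .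
  qed
  have "q \<in> ?K"
    unfolding q_def by (rule memK) (auto simp: m_def)
  moreover have "openin T U"
  proof -
    have "openin T {v \<in> topspace T. representation D v d \<in> {- (1 / m^2)<..<1 / m^2}}" for d
    proof (rule openin_continuous_map_preimage)
      show "continuous_map T euclideanreal (\<lambda>v. representation D v d)"
        by (rule continuous_linear_functional)
          (simp add: linear_functional_on_def VD representation_add representation_scale D(2))
    qed simp
    then show ?thesis unfolding U_def using fin
      by (cases "D = {}") (auto intro!: openin_Int openin_Inter)
  qed
  moreover have "0 \<in> U"
    using m subspace_0[OF subspace_V(1)]
    by (simp add: U_def topspace_eq_V representation_zero)
  moreover have "(\<lambda>u. q + u) ` U \<subseteq> ?K"
  proof clarsimp
    fix u assume u: "u \<in> U"
    then have uD: "u \<in> span D" by (simp add: U_def topspace_eq_V VD)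
    have r: "- (1 / m^2) < representation D u d" "representation D u d < 1 / m^2" if "d \<in> D" for d
      using u that by (auto simp: U_def)
    have "p + (\<Sum>d\<in>D. (1 / m + representation D u d) *\<^sub>R d) \<in> ?K"
    proof (rule memK)
      fix d assume "d \<in> D"
      have "1 / m^2 \<le> 1 / m"
        using self_le_power[of m 2] by (intro frac_le) (auto simp: m_def)
      then show "0 \<le> 1 / m + representation D u d" using r(1)[OF \<open>d \<in> D\<close>] by linarith
    next
      have "(\<Sum>d\<in>D. 1 / m + representation D u d) \<le> (\<Sum>d\<in>D. 1 / m + 1 / m^2)"
        using r(2) by (intro sum_mono) (auto intro: less_imp_le)
      also have "\<dots> = (m - 1) * (1 / m + 1 / m^2)" by (simp add: m_def)
      also have "\<dots> = 1 - 1 / m^2"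
        using m by (simp add: field_simps power2_eq_square)
      also have "\<dots> \<le> 1" by simp
      finally show "(\<Sum>d\<in>D. 1 / m + representation D u d) \<le> 1" .
    qed
    also have "p + (\<Sum>d\<in>D. (1 / m + representation D u d) *\<^sub>R d) = q + u"
      using sum_representation_eq[OF D(2) uD fin order_refl]
      by (simp add: q_def scaleR_add_left sum.distrib)
    finally show "q + u \<in> ?K" .
  qed
  ultimately show ?thesis using that by blast
qed

text \<open>Take \<open>x\<close> in \<open>j\<close>
  S\<open>so close to\<close>y\<open>that\<close>k (y -
  x)\<open>lies in\<close>U\<open>, where\<close>k = (1 - e) / e\<open>. Then\<close>(1 - e) y + e q
  = (1 - e) x + e (q + k (y - x))\<open>is a convex combination of two points of\<close>j
  \<open>S\<close>.\<close>

lemma absorbing_point_exists: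
  obtains q where "q \<in> j ` S"
    "\<And>y e. y \<in> C \<Longrightarrow> 0 < e \<Longrightarrow> e \<le> 1 \<Longrightarrow> (1 - e) *\<^sub>R y + e *\<^sub>R q \<in> j ` S"
proof -
  obtain q U where q: "q \<in> j ` S" and U: "openin T U" "0 \<in> U" "(\<lambda>u. q + u) ` U \<subseteq> j ` S"
    by (rule interior_point_exists)
  have "(1 - e) *\<^sub>R y + e *\<^sub>R q \<in> j ` S" if y: "y \<in> C" and e: "0 < e" "e \<le> 1" for y e
  proof -
    define k where "k = (1 - e) / e"
    have W: "subspace (topspace T)"
      using tvs_completed unfolding locally_convex_Hausdorff_tvs_def by blast
    have yW: "y \<in> topspace T" using y C_closure by (simp add: in_closure_of)
    let ?N = "{x \<in> topspace T. k *\<^sub>R (y + (-1) *\<^sub>R x) \<in> U}"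
    have "openin T ?N"
      using yW U(1)
      by (intro openin_continuous_map_preimage[of T T] tvs_continuous_map_scaleR[OF tvs_completed]
          tvs_continuous_map_add[OF tvs_completed]) auto
    moreover have "y \<in> ?N" using yW U(2) by simp
    ultimately have "\<exists>x. x \<in> j ` S \<and> x \<in> ?N"
      using y[unfolded C_closure in_closure_of, THEN conjunct2, rule_format, of ?N] by simp
    then obtain x where "x \<in> j ` S" "x \<in> ?N" by auto
    then have x: "x \<in> j ` S" "k *\<^sub>R (y + (-1) *\<^sub>R x) \<in> U" by auto
    then have "q + k *\<^sub>R (y - x) \<in> j ` S" using U(3) by auto
    then have "(1 - e) *\<^sub>R x + e *\<^sub>R (q + k *\<^sub>R (y - x)) \<in> j ` S"
      using x(1) e embedded(2) by (intro convexD_alt) auto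
    moreover have "(1 - e) *\<^sub>R x + e *\<^sub>R (q + k *\<^sub>R (y - x)) = (1 - e) *\<^sub>R y + e *\<^sub>R q"
      using e by (simp add: k_def scaleR_add_right scaleR_diff_right)
    ultimately show ?thesis by simp
  qed
  then show ?thesis using that q by blast
qed

end

section \<open>Neighbourhoods of a map along a segment\<close>

text \<open>Convergence need only be tested on a subbase: finite intersections become conjunctions
  of eventual statements, and for a union one member containing \<open>f\<close> suffices.\<close>

lemma eventually_generate_topology_on:
  assumes "generate_topology_on \<B> W" "f \<in> W"
    and "\<And>s. s \<in> \<B> \<Longrightarrow> f \<in> s \<Longrightarrow> eventually (\<lambda>e. g e \<in> s) F"
  shows "eventually (\<lambda>e. g e \<in> W) F"
  using assms(1,2)
proof induction
  case (Int a b)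
  then show ?case by (auto intro: eventually_conj)
next
  case (UN K)
  then obtain k where "k \<in> K" "f \<in> k" by blast
  with UN have "eventually (\<lambda>e. g e \<in> k) F" by blast
  then show ?case by eventually_elim (use \<open>k \<in> K\<close> in blast)
qed (use assms(3) in auto)

text \<open>The map \<open>?h\<close> is jointly continuous in parameter and point, and its preimage
  of \<open>U\<close> contains the slice \<open>{0} \<times> K\<close>. Compactness of
  \<open>K\<close> yields one parameter neighbourhood \<open>N\<close> valid for all of
  \<open>K\<close>.\<close>

lemma eventually_segment_image_subset:
  assumes tvs: "locally_convex_Hausdorff_tvs T"
    and f: "continuous_map X T f" and q: "q \<in> topspace T"
    and K: "compactin X K" and U: "openin T U" "f ` K \<subseteq> U"
  shows "eventually (\<lambda>e. \<forall>x\<in>K. (1 - e) *\<^sub>R f x + e *\<^sub>R q \<in> U) (at_right 0)"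
proof -
  let ?h = "\<lambda>z. (1 - fst z) *\<^sub>R f (snd z) + fst z *\<^sub>R q"
  let ?P = "prod_topology euclideanreal X"
  have "continuous_map ?P T (\<lambda>z. f (snd z))"
    using continuous_map_compose[OF continuous_map_snd f] by (simp add: o_def)
  then have "continuous_map ?P T ?h"
    using q by (intro tvs_continuous_map_add[OF tvs] tvs_continuous_map_scaleR[OF tvs]
        continuous_intros) (auto intro: continuous_map_fst)
  then have W: "openin ?P {z \<in> topspace ?P. ?h z \<in> U}"
    using U(1) by (rule openin_continuous_map_preimage)
  have "{0} \<times> K \<subseteq> {z \<in> topspace ?P. ?h z \<in> U}"
    using U(2) compactin_subset_topspace[OF K] by auto
  with tube_lemma_right[OF W K, of 0] obtain N M where
    N: "openin euclideanreal N" "0 \<in> N" "K \<subseteq> M" "N \<times> M \<subseteq> {z \<in> topspace ?P. ?h z \<in> U}"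
    by auto
  then have "eventually (\<lambda>e. e \<in> N) (at_right 0)"
    by (intro topological_tendstoD[OF tendsto_ident_at]) auto
  then show ?thesis
    by eventually_elim (use N(3,4) in force)
qed

section \<open>Density of the two sets of affine maps\<close>

theorem proposition7:
  fixes S1 :: "'a::real_vector set" and S2 :: "'b::real_vector set"
    and j1 :: "'a \<Rightarrow> 'v::real_vector" and j2 :: "'b \<Rightarrow> 'w::real_vector"
    and C1 V1 :: "'v set" and C2 V2 :: "'w set"
    and T1 :: "'v topology" and T2 :: "'w topology"
  assumes "separated_convex_set S1" and "separated_convex_set S2"
    and "convex_completion S1 j1 C1 V1 T1"
    and "convex_completion S2 j2 C2 V2 T2"
    and "finite_dimensional_convex S2"
  defines "X1 \<equiv> subtopology T1 C1" and "X2 \<equiv> subtopology T2 C2"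
  defines "A \<equiv> subtopology (essential_open_topology X1 (j1 ` S1) X2 (j2 ` S2))
                 (continuous_affine_maps X1 X2)"
  shows "dense_in A (continuous_affine_maps_into X1 X2 (j2 ` S2)) \<and>
         dense_in A (continuous_affine_maps_preserving X1 (j1 ` S1) X2 (j2 ` S2))"
proof -
  interpret c1: convex_completion S1 j1 C1 V1 T1 by fact
  interpret c2: finite_dimensional_convex_completion S2 j2 C2 V2 T2
    using assms(2,4,5)
    by (simp add: finite_dimensional_convex_completion_def
        finite_dimensional_convex_completion_axioms_def separated_convex_set_def)
  have top1: "topspace X1 = C1" and top2: "topspace X2 = C2"
    using compactin_subset_topspace[OF c1.C_properties(2)]
      compactin_subset_topspace[OF c2.C_properties(2)] by (auto simp: X1_def X2_def)
  have comp1: "compact_space X1"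
    using c1.C_properties(2) by (simp add: X1_def compact_space_subtopology)
  have S1C: "j1 ` S1 \<subseteq> C1"
    unfolding c1.C_closure using c1.embedded(1) c1.subspace_V(2)
    by (auto intro!: closure_of_subset[THEN subsetD])
  have S2C: "j2 ` S2 \<subseteq> C2"
    unfolding c2.C_closure using c2.embedded(1) c2.subspace_V(2)
    by (auto intro!: closure_of_subset[THEN subsetD])
  obtain q where q: "q \<in> j2 ` S2"
    and absorb: "\<And>y e. y \<in> C2 \<Longrightarrow> 0 < e \<Longrightarrow> e \<le> 1 \<Longrightarrow> (1 - e) *\<^sub>R y + e *\<^sub>R q \<in> j2 ` S2"
    by (rule c2.absorbing_point_exists) blast
  have qT: "q \<in> topspace T2"
    using q c2.embedded(1) c2.subspace_V(2) by blast
  let ?M = "continuous_affine_maps X1 X2" and ?D = "continuous_affine_maps_into X1 X2 (j2 ` S2)"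
  have topA: "topspace A = ?M"
    by (auto simp: A_def topspace_essential_open_topology continuous_affine_maps_def)
  have dense: "?M \<subseteq> A closure_of ?D"
  proof
    fix f assume fM: "f \<in> ?M"
    have f: "f \<in> C1 \<rightarrow>\<^sub>E C2" "continuous_map X1 X2 f" "affine_on C1 f"
      using fM by (auto simp: continuous_affine_maps_def continuous_maps_def top1 top2)
    have fT: "continuous_map X1 T2 f"
      using f(2) by (simp add: X2_def continuous_map_in_subtopology)
    have fC: "f x \<in> C2" if "x \<in> C1" for x using f(1) that by auto
    \<comment> \<open>The restriction to \<open>C1\<close> makes \<open>g e\<close> extensional, as
      membership in \<open>continuous_maps\<close> demands.\<close>
    define g where "g e = restrict (\<lambda>x. (1 - e) *\<^sub>R f x + e *\<^sub>R q) C1" for e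
    have gD: "g e \<in> ?D" if e: "0 < e" "e \<le> 1" for e
    proof -
      have gS: "g e x \<in> j2 ` S2" if "x \<in> C1" for x
        using absorb[OF fC[OF that] e] that by (simp add: g_def)
      have "continuous_map X1 T2 (\<lambda>x. (1 - e) *\<^sub>R f x + e *\<^sub>R q)"
        using fT qT by (intro tvs_continuous_map_add[OF c2.tvs_completed]
            tvs_continuous_map_scaleR[OF c2.tvs_completed]) auto
      then have "continuous_map X1 T2 (g e)"
        by (rule continuous_map_eq) (simp add: g_def top1)
      then have cont: "continuous_map X1 X2 (g e)"
        using gS S2C by (auto simp: X2_def continuous_map_in_subtopology top1[unfolded X1_def] top1)
      have "affine_on C1 (g e)"
        unfolding affine_on_def
      proof (intro ballI)
        fix x y and t :: real assume xyt: "x \<in> C1" "y \<in> C1" "t \<in> {0..1}"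
        then have "(1 - t) *\<^sub>R x + t *\<^sub>R y \<in> C1"
          using convexD_alt[OF c1.C_properties(1)] by auto
        moreover have "f ((1 - t) *\<^sub>R x + t *\<^sub>R y) = (1 - t) *\<^sub>R f x + t *\<^sub>R f y"
          using f(3) xyt unfolding affine_on_def by blast
        ultimately show "g e ((1 - t) *\<^sub>R x + t *\<^sub>R y) = (1 - t) *\<^sub>R g e x + t *\<^sub>R g e y"
          using xyt unfolding g_def
          by (simp only: restrict_apply if_True) (simp add: algebra_simps)
      qed
      moreover have "g e \<in> C1 \<rightarrow>\<^sub>E C2"
        using gS S2C by (auto simp: g_def)
      ultimately show ?thesis
        using cont gS by (auto simp: continuous_affine_maps_into_def continuous_affine_maps_def
            continuous_maps_def top1 top2)
    qed
    have small: "eventually (\<lambda>e::real. 0 < e \<and> e \<le> 1) (at_right 0)"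
      unfolding eventually_at_right_field by (rule exI[of _ 1]) auto
    let ?\<B> = "{{f \<in> continuous_maps X1 X2. f ` K \<subseteq> U} |K U.
          essential_closedin X1 (j1 ` S1) K \<and> essential_openin X2 (j2 ` S2) U}"
    have sub: "eventually (\<lambda>e. g e \<in> s) (at_right 0)" if "s \<in> ?\<B>" "f \<in> s" for s
    proof -
      obtain K U where s: "s = {f \<in> continuous_maps X1 X2. f ` K \<subseteq> U}"
        and K: "closedin X1 K" and U: "openin X2 U"
        using \<open>s \<in> ?\<B>\<close> by (auto simp: essential_closedin_def essential_openin_def)
      have fK: "f ` K \<subseteq> U" using \<open>f \<in> s\<close> s by simp
      have KC: "K \<subseteq> C1" using closedin_subset[OF K] top1 by simp
      \<comment> \<open>The segment lemma works in the vector space topology \<open>T2\<close>, so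
        \<open>U\<close> is replaced by an open set \<open>U'\<close> with trace \<open>U\<close> on
        \<open>C2\<close>; that \<open>g e\<close> has values in \<open>C2\<close> comes from
        \<open>gD\<close>.\<close>
      obtain U' where U': "openin T2 U'" "U = U' \<inter> C2"
        using U by (auto simp: X2_def openin_subtopology)
      have "compactin X1 K" using closedin_compact_space[OF comp1 K] .
      then have "eventually (\<lambda>e. \<forall>x\<in>K. (1 - e) *\<^sub>R f x + e *\<^sub>R q \<in> U') (at_right 0)"
        using eventually_segment_image_subset[OF c2.tvs_completed fT qT _ U'(1)] fK U'(2) by blast
      with small show ?thesis
      proof eventually_elim
        case (elim e)
        then have ge: "g e \<in> ?D" using gD by blast
        have "g e x \<in> U" if "x \<in> K" for x
        proof -
          have "x \<in> C1" using that KC by blast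
          then have "g e x \<in> C2"
            using ge S2C unfolding continuous_affine_maps_into_def top1 by blast
          then show ?thesis using elim that \<open>x \<in> C1\<close> U'(2) by (simp add: g_def)
        qed
        then show ?case
          using ge by (auto simp: s continuous_affine_maps_into_def continuous_affine_maps_def)
      qed
    qed
    show "f \<in> A closure_of ?D"
      unfolding in_closure_of
    proof (intro conjI allI impI)
      show "f \<in> topspace A" using fM topA by simp
      fix N assume N: "f \<in> N \<and> openin A N"
      then obtain W where W: "openin (essential_open_topology X1 (j1 ` S1) X2 (j2 ` S2)) W"
        "N = W \<inter> ?M"
        by (auto simp: A_def openin_subtopology)
      then have "generate_topology_on ?\<B> W"
        unfolding essential_open_topology_def by (simp add: openin_topology_generated_by)
      then have "eventually (\<lambda>e. g e \<in> W) (at_right 0)"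
        using N W(2) sub by (intro eventually_generate_topology_on[of ?\<B> W f]) auto
      with small have "eventually (\<lambda>e. g e \<in> W \<and> g e \<in> ?D) (at_right 0)"
        by eventually_elim (use gD in blast)
      \<comment> \<open>The filter \<open>at_right 0\<close> is nontrivial, so an eventual property
        holds for some actual \<open>e\<close>.\<close>
      then obtain e where "g e \<in> W" "g e \<in> ?D"
        using eventually_happens'[OF trivial_limit_at_right_real] by blast
      then show "\<exists>y. y \<in> ?D \<and> y \<in> N"
        using W(2) by (auto simp: continuous_affine_maps_into_def)
    qed
  qed
  have incl: "?D \<subseteq> continuous_affine_maps_preserving X1 (j1 ` S1) X2 (j2 ` S2)"
    using S1C by (auto simp: continuous_affine_maps_into_def continuous_affine_maps_preserving_def top1)
  \<comment> \<open>Closure is monotone, so density of \<open>?D\<close> passes to every set between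
    \<open>?D\<close> and \<open>?M\<close>, which covers both claims.\<close>
  have "dense_in A D'" if "?D \<subseteq> D'" "D' \<subseteq> ?M" for D'
    using dense closure_of_mono[OF that(1), of A] closure_of_subset_topspace[of A D'] that(2)
    by (auto simp: dense_in_def topA)
  moreover have "?D \<subseteq> ?M" "continuous_affine_maps_preserving X1 (j1 ` S1) X2 (j2 ` S2) \<subseteq> ?M"
    by (auto simp: continuous_affine_maps_into_def continuous_affine_maps_preserving_def)
  ultimately show ?thesis using incl by blast
qed

end
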